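(* Let $G$ be a finite digraph, let $P$ be a finite poset and let $k>1$ be an integer. The $k$-walks of $G$ are $P$-colorable if and only if the $(k-1)$-walks of $G$ are $A(P)$-colorable.
   Context: A digraph $G=(V,E)$ has a finite vertex set $V$ and edges that are ordered pairs $(i,j)$ of distinct vertices (no loops, no multiple edges); write $i\to j$ if $(i,j)\in E$. For $k\ge 1$, a $k$-walk is a sequence $(v_1v_2\dots v_k)$ of vertices with $v_1\to v_2\to\dots\to v_k$ (its length is $k-1$; a 1-walk is a single vertex). For a finite poset $P$, a $P$-coloring of the $k$-walks of $G$ is a map $c_k$ from the set of $k$-walks to $P$ such that for every $(k+1)$-walk $(v_1\dots v_{k+1})$, $c_k(v_1\dots v_k)\not\le c_k(v_2\dots v_{k+1})$. $A(P)$ denotes the set of all antichains of $P$ (including the empty antichain), partially ordered by $X\le Y$ iff for every $x\in X$ there is $y\in Y$ with $x\le y$ (this poset is isomorphic to the lattice of lower order ideals of $P$ ordered by inclusion). *)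

theory Defs
  imports
    "Graph_Theory.Pair_Digraph"
    "Graph_Theory.Vertex_Walk"
    "HOL-Library.FuncSet"
begin

text \<open>A poset is a carrier \<open>P\<close> with a relation \<open>r\<close> such that \<open>partial_order_on P r\<close>;
  \<open>(x, y) \<in> r\<close> means \<open>x \<le> y\<close>. Carriers are used instead of a type class so that the empty
  poset is covered.\<close>

definition k_walks :: "'v pair_pre_digraph \<Rightarrow> nat \<Rightarrow> 'v list set" where
  "k_walks G k = {w. vwalk w (with_proj G) \<and> length w = k}"

text \<open>For a walk \<open>w = (v\<^sub>1 \<dots> v\<^sub>k\<^sub>+\<^sub>1)\<close>, \<open>butlast w\<close> is \<open>(v\<^sub>1 \<dots> v\<^sub>k)\<close> and \<open>tl w\<close> is
  \<open>(v\<^sub>2 \<dots> v\<^sub>k\<^sub>+\<^sub>1)\<close>. Values of \<open>c\<close> outside the \<open>k\<close>-walks are irrelevant.\<close>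

definition is_walk_coloring ::
    "'v pair_pre_digraph \<Rightarrow> nat \<Rightarrow> 'p set \<Rightarrow> 'p rel \<Rightarrow> ('v list \<Rightarrow> 'p) \<Rightarrow> bool" where
  "is_walk_coloring G k P r c \<longleftrightarrow>
     c \<in> k_walks G k \<rightarrow> P \<and>
     (\<forall>w \<in> k_walks G (k + 1). (c (butlast w), c (tl w)) \<notin> r)"

definition walks_colorable :: "'v pair_pre_digraph \<Rightarrow> nat \<Rightarrow> 'p set \<Rightarrow> 'p rel \<Rightarrow> bool" where
  "walks_colorable G k P r \<longleftrightarrow> (\<exists>c. is_walk_coloring G k P r c)"

definition antichains :: "'p set \<Rightarrow> 'p rel \<Rightarrow> 'p set set" where
  "antichains P r = {X. X \<subseteq> P \<and> (\<forall>x\<in>X. \<forall>y\<in>X. (x, y) \<in> r \<longrightarrow> x = y)}"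

definition antichain_order :: "'p set \<Rightarrow> 'p rel \<Rightarrow> 'p set rel" where
  "antichain_order P r =
     {(X, Y). X \<in> antichains P r \<and> Y \<in> antichains P r \<and> (\<forall>x\<in>X. \<exists>y\<in>Y. (x, y) \<in> r)}"

lemma partial_order_on_antichain_order:
  assumes "partial_order_on P r"
  shows "partial_order_on (antichains P r) (antichain_order P r)"
proof -
  have rfl: "\<And>x. x \<in> P \<Longrightarrow> (x, x) \<in> r"
    using partial_order_onD(1)[OF assms] by (auto simp: refl_on_def)
  have tr: "\<And>x y z. (x, y) \<in> r \<Longrightarrow> (y, z) \<in> r \<Longrightarrow> (x, z) \<in> r"
    using partial_order_onD(2)[OF assms] by (auto dest: transD)
  have as: "\<And>x y. (x, y) \<in> r \<Longrightarrow> (y, x) \<in> r \<Longrightarrow> x = y"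
    using partial_order_onD(3)[OF assms] by (auto dest: antisymD)
  have sub: "X \<subseteq> Y" if le: "(X, Y) \<in> antichain_order P r" "(Y, X) \<in> antichain_order P r" for X Y
  proof
    fix x assume x: "x \<in> X"
    then obtain y where y: "y \<in> Y" "(x, y) \<in> r" using le by (auto simp: antichain_order_def)
    then obtain z where z: "z \<in> X" "(y, z) \<in> r" using le by (auto simp: antichain_order_def)
    have "X \<in> antichains P r" using le by (auto simp: antichain_order_def)
    then have "x = z" using x z tr[OF y(2) z(2)] by (auto simp: antichains_def)
    then show "x \<in> Y" using as y z by auto
  qed
  have "refl_on (antichains P r) (antichain_order P r)"
    by (auto simp: refl_on_def antichain_order_def antichains_def intro: rfl)
  moreover have "trans (antichain_order P r)"
    unfolding trans_def antichain_order_def by (clarsimp, meson tr)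
  moreover have "antisym (antichain_order P r)"
    using sub by (auto intro!: antisymI)
  moreover have "antichain_order P r \<subseteq> antichains P r \<times> antichains P r"
    by (auto simp: antichain_order_def)
  ultimately show ?thesis by (simp add: partial_order_on_def preorder_on_def)
qed

end

theory Submission
  imports Defs
begin

text \<open>Passing down, a walk \<open>u\<close> receives the maximal colours of its one-step extensions to the
  right; the lower ideal generated by them contains all those colours. Passing up, a walk \<open>w\<close>
  receives an element of the antichain of \<open>butlast w\<close> witnessing that this antichain is not below
  the antichain of \<open>tl w\<close>.\<close>

lemma butlast_in_k_walks:
  assumes "w \<in> k_walks G (Suc n)" and "0 < n"
  shows "butlast w \<in> k_walks G n"
proof -
  have "w \<noteq> []" using assms by (auto simp: k_walks_def)
  then have "set (vwalk_arcs (butlast w)) \<subseteq> set (vwalk_arcs w)"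
    using set_vwalk_arcs_append1[of "butlast w" "[last w]"] by simp
  moreover have "length (butlast w) = n"
    using assms by (simp add: k_walks_def)
  moreover have "butlast w \<noteq> []"
    using calculation(2) assms(2) by (metis length_greater_0_conv)
  ultimately show ?thesis
    using assms by (auto simp: k_walks_def vwalk_def dest: in_set_butlastD)
qed

lemma tl_in_k_walks:
  assumes "w \<in> k_walks G (Suc n)" and "0 < n"
  shows "tl w \<in> k_walks G n"
  using assms by (cases w) (auto simp: k_walks_def elim: vwalk_consE)

text \<open>Being a walk is a condition on consecutive vertices only, so two walks glue along a
  common stretch. With \<open>0 < n\<close> the stretch \<open>tl w\<close> is nonempty, so every
  arc of \<open>x\<close> already lies in \<open>w\<close> or in \<open>w'\<close>.\<close>

lemma k_walks_overlap:
  assumes "w \<in> k_walks G (Suc n)" and "w' \<in> k_walks G (Suc n)"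
    and "butlast w' = tl w" and "0 < n"
  obtains x where "x \<in> k_walks G (Suc (Suc n))" and "butlast x = w" and "tl x = w'"
proof -
  obtain a u where w: "w = a # u" and u: "u \<noteq> []"
    using assms by (cases w) (auto simp: k_walks_def)
  have "w' \<noteq> []" using assms(2) by (auto simp: k_walks_def)
  then obtain b where w': "w' = u @ [b]"
    using assms(3) w by (cases w' rule: rev_cases) auto
  have "vwalk (a # u) (with_proj G)" "vwalk w' (with_proj G)" "length w' = Suc n"
    using assms(1,2) w by (auto simp: k_walks_def)
  then have "a # w' \<in> k_walks G (Suc (Suc n))"
    using u by (auto simp: k_walks_def vwalk_def w')
  then show thesis by (rule that) (simp_all add: w w')
qed

definition maximal_elements :: "'p rel \<Rightarrow> 'p set \<Rightarrow> 'p set" where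
  "maximal_elements r X = {x \<in> X. \<forall>y\<in>X. (x, y) \<in> r \<longrightarrow> x = y}"

lemma maximal_elements_in_antichains:
  "X \<subseteq> P \<Longrightarrow> maximal_elements r X \<in> antichains P r"
  by (auto simp: maximal_elements_def antichains_def)

lemma maximal_elements_above:
  assumes "partial_order_on P r" and "finite P" and "X \<subseteq> P" and "x \<in> X"
  obtains m where "m \<in> maximal_elements r X" and "(x, m) \<in> r"
proof -
  have rfl: "(x, x) \<in> r"
    using partial_order_onD(1)[OF assms(1)] assms(3,4) by (auto simp: refl_on_def)
  have tr: "trans r" and as: "antisym r"
    using partial_order_onD[OF assms(1)] by auto
  \<comment> \<open>The maximum is sought only above \<open>x\<close>. By transitivity, anything in
    \<open>X\<close> above a member of \<open>?Y\<close> is again in \<open>?Y\<close>, so an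
    element maximal in \<open>?Y\<close> is maximal in \<open>X\<close>.\<close>
  let ?Y = "{y \<in> X. (x, y) \<in> r}"
  have "finite ?Y" using finite_subset[OF assms(3,2)] by simp
  moreover have "transp_on ?Y (\<lambda>a b. (a, b) \<in> r \<and> a \<noteq> b)"
    using tr as by (auto simp: transp_on_def dest: transD antisymD)
  moreover have "asymp_on ?Y (\<lambda>a b. (a, b) \<in> r \<and> a \<noteq> b)"
    using as by (auto simp: asymp_on_def dest: antisymD)
  ultimately obtain m where "m \<in> ?Y" and m: "\<forall>y\<in>?Y. y \<noteq> m \<longrightarrow> \<not> ((m, y) \<in> r \<and> m \<noteq> y)"
    using Finite_Set.bex_max_element[of ?Y "\<lambda>a b. (a, b) \<in> r \<and> a \<noteq> b"] rfl assms(4) by blast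
  moreover have "y \<in> ?Y" if "y \<in> X" "(m, y) \<in> r" for y
    using that \<open>m \<in> ?Y\<close> transD[OF tr, of x m y] by simp
  ultimately have "m \<in> maximal_elements r X"
    by (auto simp: maximal_elements_def)
  then show thesis using that \<open>m \<in> ?Y\<close> by simp
qed

text \<open>A comparison between the antichains of \<open>butlast w\<close> and \<open>tl w\<close>
  would put \<open>c w\<close> below the colour of some \<open>w'\<close> that extends
  \<open>tl w\<close>; gluing \<open>w\<close> and \<open>w'\<close> then gives a longer walk that
  violates the colouring \<open>c\<close>.\<close>

lemma walks_colorable_antichains_of_Suc:
  assumes "finite P" and po: "partial_order_on P r" and "0 < n"
    and "walks_colorable G (Suc n) P r"
  shows "walks_colorable G n (antichains P r) (antichain_order P r)"
proof -
  obtain c where cP: "c \<in> k_walks G (Suc n) \<rightarrow> P"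
    and c: "\<And>x. x \<in> k_walks G (Suc (Suc n)) \<Longrightarrow> (c (butlast x), c (tl x)) \<notin> r"
    using assms(4) by (auto simp: walks_colorable_def is_walk_coloring_def)
  \<comment> \<open>If \<open>u\<close> has no extension to the right, \<open>E u\<close> is empty
    and \<open>u\<close> receives the empty antichain.\<close>
  define E where "E u = c ` {w \<in> k_walks G (Suc n). butlast w = u}" for u
  have EP: "E u \<subseteq> P" for u using cP by (auto simp: E_def)
  have "(maximal_elements r (E (butlast w)), maximal_elements r (E (tl w))) \<notin> antichain_order P r"
    if w: "w \<in> k_walks G (Suc n)" for w
  proof
    assume le: "(maximal_elements r (E (butlast w)), maximal_elements r (E (tl w)))
      \<in> antichain_order P r"
    have "c w \<in> E (butlast w)" using w by (auto simp: E_def)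
    then obtain m where m: "m \<in> maximal_elements r (E (butlast w))" "(c w, m) \<in> r"
      using maximal_elements_above[OF po assms(1) EP] by blast
    then obtain y where "y \<in> E (tl w)" "(m, y) \<in> r"
      using le by (auto simp: antichain_order_def maximal_elements_def)
    then obtain w' where w': "w' \<in> k_walks G (Suc n)" "butlast w' = tl w" "(m, c w') \<in> r"
      by (auto simp: E_def)
    obtain x where "x \<in> k_walks G (Suc (Suc n))" "butlast x = w" "tl x = w'"
      using k_walks_overlap[OF w w'(1,2) assms(3)] .
    moreover have "(c w, c w') \<in> r"
      using m(2) w'(3) partial_order_onD(2)[OF po] by (auto dest: transD)
    ultimately show False using c by blast
  qed
  then have "is_walk_coloring G n (antichains P r) (antichain_order P r)
      (\<lambda>u. maximal_elements r (E u))"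
    using maximal_elements_in_antichains[OF EP] by (auto simp: is_walk_coloring_def)
  then show ?thesis by (auto simp: walks_colorable_def)
qed

lemma walks_colorable_Suc_of_antichains:
  assumes "0 < n"
    and "walks_colorable G n (antichains P r) (antichain_order P r)"
  shows "walks_colorable G (Suc n) P r"
proof -
  obtain C where CA: "C \<in> k_walks G n \<rightarrow> antichains P r"
    and C: "\<And>w. w \<in> k_walks G (Suc n) \<Longrightarrow> (C (butlast w), C (tl w)) \<notin> antichain_order P r"
    using assms(2) by (auto simp: walks_colorable_def is_walk_coloring_def)
  have "\<exists>x. x \<in> C (butlast w) \<and> (\<forall>y\<in>C (tl w). (x, y) \<notin> r)" if w: "w \<in> k_walks G (Suc n)" for w
    \<comment> \<open>\<open>antichain_order\<close> also requires both sides to be antichains.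
      Since \<open>butlast w\<close> and \<open>tl w\<close> are walks, this holds for their
      colours, so only the domination clause can fail, and its failure yields
      \<open>x\<close>.\<close>
    using C[OF w] CA butlast_in_k_walks[OF w assms(1)] tl_in_k_walks[OF w assms(1)]
    by (auto simp: antichain_order_def)
  then obtain c where cC: "\<And>w. w \<in> k_walks G (Suc n) \<Longrightarrow> c w \<in> C (butlast w)"
    and c: "\<And>w y. w \<in> k_walks G (Suc n) \<Longrightarrow> y \<in> C (tl w) \<Longrightarrow> (c w, y) \<notin> r"
    by metis
  have "c w \<in> P" if w: "w \<in> k_walks G (Suc n)" for w
    using cC[OF w] CA butlast_in_k_walks[OF w assms(1)] by (auto simp: antichains_def)
  moreover have "(c (butlast x), c (tl x)) \<notin> r" if x: "x \<in> k_walks G (Suc (Suc n))" for x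
  \<comment> \<open>The rule is used with \<open>butlast x\<close> as the walk and
    \<open>c (tl x)\<close> as \<open>y\<close>. Both walks share the middle stretch
    \<open>tl (butlast x) = butlast (tl x)\<close>: the colour of \<open>tl x\<close> is chosen from
    its antichain, while that of \<open>butlast x\<close> lies below none of its elements.\<close>
  proof (rule c)
    show "butlast x \<in> k_walks G (Suc n)" using butlast_in_k_walks[OF x] by simp
    have "c (tl x) \<in> C (butlast (tl x))" using cC tl_in_k_walks[OF x] by simp
    then show "c (tl x) \<in> C (tl (butlast x))" by (simp add: butlast_tl)
  qed
  ultimately show ?thesis by (auto simp: walks_colorable_def is_walk_coloring_def)
qed

theorem mainTheorem1:
  fixes G :: "'v pair_pre_digraph"
    and P :: "'p set" and r :: "'p rel"
    and k :: nat
  assumes "pair_digraph G"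
    and "finite P" and "partial_order_on P r"
    and "k > 1"
  shows "walks_colorable G k P r \<longleftrightarrow>
         walks_colorable G (k - 1) (antichains P r) (antichain_order P r)"
proof -
  have "k = Suc (k - 1)" and "0 < k - 1" using assms(4) by auto
  then show ?thesis
    using walks_colorable_antichains_of_Suc[OF assms(2,3)] walks_colorable_Suc_of_antichains
    by metis
qed

end
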